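(* Let $(K,<)$ and $(L,<)$ be ordered fields such that $(K,<)\equiv(L,<)$. Suppose that $K$ is dense in its real closure $K^{\mathrm{rc}}$. Then $L$ is dense in its real closure $L^{\mathrm{rc}}$.
   Context: Elementary equivalence $\equiv$ is in the language $\mathcal{L}_{\mathrm{or}}=\{+,-,\cdot,0,1,<\}$ of ordered rings. For an ordered field $(K,<)$, $K^{\mathrm{rc}}$ is its real closure (with ordering extending that of $K$). $K$ is dense in $K^{\mathrm{rc}}$ if for all $a<b$ in $K^{\mathrm{rc}}$ there is $c\in K$ with $a<c<b$. *)

theory Defs
  imports Complex_Main "HOL-Computational_Algebra.Polynomial"
begin

subsection \<open>First-order logic in the language of ordered rings\<close>

text \<open>
  The signature is \<open>{+, -, \<cdot>, 0, 1, <}\<close>, where \<open>-\<close> is the binary subtraction symbol.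
  Variables are indexed by natural numbers; the variable bound by a quantifier is named explicitly.
\<close>

datatype or_term =
    Var nat
  | Zero
  | One
  | Plus or_term or_term
  | Minus or_term or_term
  | Times or_term or_term

datatype or_formula =
    Equal or_term or_term
  | Less or_term or_term
  | Neg or_formula
  | Conj or_formula or_formula
  | Disj or_formula or_formula
  | Impl or_formula or_formula
  | Forall nat or_formula
  | Exists nat or_formula

primrec term_vars :: "or_term \<Rightarrow> nat set" where
  "term_vars (Var n) = {n}"
| "term_vars Zero = {}"
| "term_vars One = {}"
| "term_vars (Plus s t) = term_vars s \<union> term_vars t"
| "term_vars (Minus s t) = term_vars s \<union> term_vars t"
| "term_vars (Times s t) = term_vars s \<union> term_vars t"

primrec free_vars :: "or_formula \<Rightarrow> nat set" where
  "free_vars (Equal s t) = term_vars s \<union> term_vars t"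
| "free_vars (Less s t) = term_vars s \<union> term_vars t"
| "free_vars (Neg \<phi>) = free_vars \<phi>"
| "free_vars (Conj \<phi> \<psi>) = free_vars \<phi> \<union> free_vars \<psi>"
| "free_vars (Disj \<phi> \<psi>) = free_vars \<phi> \<union> free_vars \<psi>"
| "free_vars (Impl \<phi> \<psi>) = free_vars \<phi> \<union> free_vars \<psi>"
| "free_vars (Forall n \<phi>) = free_vars \<phi> - {n}"
| "free_vars (Exists n \<phi>) = free_vars \<phi> - {n}"

definition is_sentence :: "or_formula \<Rightarrow> bool" where
  "is_sentence \<phi> \<longleftrightarrow> free_vars \<phi> = {}"

primrec term_val :: "(nat \<Rightarrow> 'a::linordered_field) \<Rightarrow> or_term \<Rightarrow> 'a" where
  "term_val e (Var n) = e n"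
| "term_val e Zero = 0"
| "term_val e One = 1"
| "term_val e (Plus s t) = term_val e s + term_val e t"
| "term_val e (Minus s t) = term_val e s - term_val e t"
| "term_val e (Times s t) = term_val e s * term_val e t"

primrec satisfies :: "(nat \<Rightarrow> 'a::linordered_field) \<Rightarrow> or_formula \<Rightarrow> bool" where
  "satisfies e (Equal s t) \<longleftrightarrow> term_val e s = term_val e t"
| "satisfies e (Less s t) \<longleftrightarrow> term_val e s < term_val e t"
| "satisfies e (Neg \<phi>) \<longleftrightarrow> \<not> satisfies e \<phi>"
| "satisfies e (Conj \<phi> \<psi>) \<longleftrightarrow> satisfies e \<phi> \<and> satisfies e \<psi>"
| "satisfies e (Disj \<phi> \<psi>) \<longleftrightarrow> satisfies e \<phi> \<or> satisfies e \<psi>"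
| "satisfies e (Impl \<phi> \<psi>) \<longleftrightarrow> (satisfies e \<phi> \<longrightarrow> satisfies e \<psi>)"
| "satisfies e (Forall n \<phi>) \<longleftrightarrow> (\<forall>x. satisfies (e(n := x)) \<phi>)"
| "satisfies e (Exists n \<phi>) \<longleftrightarrow> (\<exists>x. satisfies (e(n := x)) \<phi>)"

text \<open>For a sentence the assignment is irrelevant, so quantifying over all of them is harmless.\<close>

definition models :: "'a::linordered_field itself \<Rightarrow> or_formula \<Rightarrow> bool" where
  "models K \<phi> \<longleftrightarrow> (\<forall>e :: nat \<Rightarrow> 'a. satisfies e \<phi>)"

definition elementarily_equivalent ::
  "'a::linordered_field itself \<Rightarrow> 'b::linordered_field itself \<Rightarrow> bool" where
  "elementarily_equivalent K L \<longleftrightarrow> (\<forall>\<phi>. is_sentence \<phi> \<longrightarrow> (models K \<phi> \<longleftrightarrow> models L \<phi>))"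


subsection \<open>Real closures and density\<close>

definition real_closed :: "'a::linordered_field itself \<Rightarrow> bool" where
  "real_closed R \<longleftrightarrow>
     (\<forall>x::'a. 0 \<le> x \<longrightarrow> (\<exists>y. y ^ 2 = x)) \<and>
     (\<forall>p :: 'a poly. odd (degree p) \<longrightarrow> (\<exists>x. poly p x = 0))"

definition ordered_field_embedding ::
  "('a::linordered_field \<Rightarrow> 'b::linordered_field) \<Rightarrow> bool" where
  "ordered_field_embedding i \<longleftrightarrow>
     i 0 = 0 \<and> i 1 = 1 \<and>
     (\<forall>x y. i (x + y) = i x + i y) \<and>
     (\<forall>x y. i (x * y) = i x * i y) \<and>
     strict_mono i"

definition algebraic_via ::
  "('a::linordered_field \<Rightarrow> 'b::linordered_field) \<Rightarrow> 'b \<Rightarrow> bool" where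
  "algebraic_via i x \<longleftrightarrow> (\<exists>p :: 'a poly. p \<noteq> 0 \<and> poly (map_poly i p) x = 0)"

text \<open>
  A real closure is determined only up to unique isomorphism over the base field, so it is presented
  as an embedding \<open>i\<close> of the ordered field \<open>'a\<close> into an ordered field \<open>'b\<close>.
\<close>

definition is_real_closure ::
  "('a::linordered_field \<Rightarrow> 'b::linordered_field) \<Rightarrow> bool" where
  "is_real_closure i \<longleftrightarrow>
     ordered_field_embedding i \<and> real_closed TYPE('b) \<and> (\<forall>x. algebraic_via i x)"

definition dense_via ::
  "('a::linordered_field \<Rightarrow> 'b::linordered_field) \<Rightarrow> bool" where
  "dense_via i \<longleftrightarrow> (\<forall>a b. a < b \<longrightarrow> (\<exists>c. a < i c \<and> i c < b))"

end

theory Submission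
  imports "HOL-Algebra.Algebraic_Closure_Type" Defs
begin

text \<open>
  Density of \<open>K\<close> in its real closure is not visibly a first-order property of \<open>K\<close>, because it speaks
  about elements of the real closure. It is, however, equivalent to a first-order scheme, the
  approximate intermediate value theorem: whenever a polynomial \<open>p\<close> over \<open>K\<close> is negative at \<open>a\<close> and
  positive at \<open>b > a\<close>, there are points of \<open>K\<close> between \<open>a\<close> and \<open>b\<close> at which \<open>\<bar>p\<bar>\<close> is arbitrarily small.
  For each bound on the degree this is one formula, so the scheme transfers from \<open>K\<close> to \<open>L\<close>
  (\<open>elementarily_equivalent_models\<close>, \<open>models_approximate_IVT\<close>).

  Density implies the scheme because \<open>p\<close> has a genuine root between \<open>a\<close> and \<open>b\<close> in the real closure and
  is continuous there (\<open>dense_imp_approximate_IVT\<close>). Conversely, assume the scheme. It suffices to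
  approximate each element \<open>\<alpha>\<close> of the real closure, and this goes by induction on the degree of a
  polynomial \<open>p\<close> with root \<open>\<alpha>\<close>. By induction the roots of \<open>p'\<close> can be approximated. If \<open>\<alpha>\<close> is not one of
  them, elements \<open>a < \<alpha> < b\<close> of the small field separate \<open>\<alpha>\<close> from them, so \<open>p\<close> is strictly monotone
  between \<open>a\<close> and \<open>b\<close> and changes sign. The scheme then gives a point where \<open>\<bar>p\<bar>\<close> is very small, and by
  monotonicity this point is near \<open>\<alpha>\<close> (\<open>simple_root_approximable\<close>). Since the extension is algebraic,
  each of its positive elements has a smaller positive element of the small field below it, so
  errors can be measured in the small field.

  Both directions use that real closed fields, defined by square roots and roots of polynomials of
  odd degree, satisfy the intermediate value theorem for polynomials, whence also Rolle's theorem
  and the mean value theorem. For this it is enough that every nonconstant polynomial has a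
  linear factor or a quadratic factor \<open>(X - a)\<^sup>2 + b\<^sup>2\<close> with \<open>b \<noteq> 0\<close>, that is, a root in the field with a square
  root of \<open>-1\<close> adjoined. That root is found by Laplace's argument inside an algebraic closure
  (\<open>has_root_in_sqrt_closed\<close>), where the theory of symmetric polynomials is replaced by resultants and
  interpolation (\<open>range_prod_roots\<close>, \<open>interpolation_range\<close>).
\<close>

section \<open>Embeddings of fields and their action on polynomials\<close>

locale field_embedding =
  fixes h :: "'a::field \<Rightarrow> 'b::field"
  assumes map_0 [simp]: "h 0 = 0"
    and map_1 [simp]: "h 1 = 1"
    and map_add [simp]: "h (x + y) = h x + h y"
    and map_mult [simp]: "h (x * y) = h x * h y"
begin

lemma map_minus [simp]: "h (- x) = - h x"
  by (metis add.right_inverse add_eq_0_iff map_0 map_add)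

lemma map_diff [simp]: "h (x - y) = h x - h y"
  using map_add[of x "- y"] by simp

lemma map_eq_0_iff [simp]: "h x = 0 \<longleftrightarrow> x = 0"
proof
  assume "h x = 0"
  then have "h (x * inverse x) = 0" by (simp only: map_mult mult_zero_left)
  then show "x = 0" by (metis right_inverse map_1 zero_neq_one)
qed simp

lemma map_eq_iff [simp]: "h x = h y \<longleftrightarrow> x = y"
  using map_eq_0_iff[of "x - y"] by simp

lemma map_inverse [simp]: "h (inverse x) = inverse (h x)"
  by (cases "x = 0")
    (simp, metis map_1 map_mult left_inverse inverse_unique mult.commute)

lemma map_of_nat [simp]: "h (of_nat n) = of_nat n"
  by (induction n) auto

lemma map_power [simp]: "h (x ^ n) = h x ^ n"
  by (induction n) auto

lemma degree_map [simp]: "degree (map_poly h p) = degree p"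
  by (rule degree_map_poly) simp

lemma coeff_map [simp]: "coeff (map_poly h p) n = h (coeff p n)"
  by (rule coeff_map_poly) simp

lemma map_poly_eq_0 [simp]: "map_poly h p = 0 \<longleftrightarrow> p = 0"
  by (simp add: poly_eq_iff)

lemma map_poly_add [simp]: "map_poly h (p + q) = map_poly h p + map_poly h q"
  by (intro poly_eqI) simp

lemma map_poly_pCons' [simp]: "map_poly h (pCons c p) = pCons (h c) (map_poly h p)"
  by (rule map_poly_pCons) simp

lemma map_poly_smult' [simp]: "map_poly h (smult c p) = smult (h c) (map_poly h p)"
  by (rule map_poly_smult) simp_all

lemma map_poly_mult [simp]: "map_poly h (p * q) = map_poly h p * map_poly h q"
  by (induction p) auto

lemma map_poly_pderiv: "map_poly h (pderiv p) = pderiv (map_poly h p)"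
  by (intro poly_eqI) (simp add: coeff_pderiv flip: of_nat_Suc)

lemma poly_map_poly [simp]: "poly (map_poly h p) (h x) = h (poly p x)"
  by (induction p) auto

lemma range_add: "x \<in> range h \<Longrightarrow> y \<in> range h \<Longrightarrow> x + y \<in> range h"
  by (auto simp flip: map_add)

lemma range_diff: "x \<in> range h \<Longrightarrow> y \<in> range h \<Longrightarrow> x - y \<in> range h"
  by (auto simp flip: map_diff)

lemma range_mult: "x \<in> range h \<Longrightarrow> y \<in> range h \<Longrightarrow> x * y \<in> range h"
  by (auto simp flip: map_mult)

lemma range_inverse: "x \<in> range h \<Longrightarrow> inverse x \<in> range h"
  by (auto simp flip: map_inverse)

lemma range_power: "x \<in> range h \<Longrightarrow> x ^ n \<in> range h"
  by (auto simp flip: map_power)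

lemma range_divide: "x \<in> range h \<Longrightarrow> y \<in> range h \<Longrightarrow> x / y \<in> range h"
  by (simp add: divide_inverse range_mult range_inverse)

lemma range_sum: "(\<And>i. i \<in> I \<Longrightarrow> f i \<in> range h) \<Longrightarrow> sum f I \<in> range h"
  by (induction I rule: infinite_finite_induct)
    (auto intro!: range_add simp del: map_0 intro: range_eqI[of 0 h 0] map_0[symmetric])

lemma range_map_polyI:
  assumes "\<And>n. coeff p n \<in> range h"
  shows "p \<in> range (map_poly h)"
proof (rule range_eqI)
  have inj: "inj h" by (simp add: inj_on_def)
  then have "inv_into UNIV h 0 = 0" by (metis inv_f_f map_0)
  then show "p = map_poly h (map_poly (inv_into UNIV h) p)"
    by (intro poly_eqI) (simp add: coeff_map_poly assms f_inv_into_f)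
qed

text \<open>
  This replaces the theory of symmetric polynomials: to see that a product over all roots of a
  polynomial has coefficients in the base field, it suffices to evaluate it at infinitely many
  elements of the base field. The proof is Newton interpolation, splitting off one evaluation point
  at a time.
\<close>

lemma interpolation_range:
  assumes "infinite S" "\<And>s. s \<in> S \<Longrightarrow> poly p (h s) \<in> range h"
  shows "p \<in> range (map_poly h)"
  using assms
proof (induction "degree p" arbitrary: p S)
  case 0
  then obtain c where c: "p = [:c:]" by (metis degree_eq_zeroE)
  obtain s where "s \<in> S" using 0 by fastforce
  with 0 c have "c \<in> range h" by auto
  then obtain a where "c = h a" by blast
  with c have "p = map_poly h [:a:]" by simp
  then show ?case by blast
next
  case (Suc d)
  obtain s where s: "s \<in> S" using Suc by fastforce
  define q where "q = synthetic_div p (h s)"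
  have p: "p = [:- h s, 1:] * q + [:poly p (h s):]"
    unfolding q_def by (rule synthetic_div_correct'[symmetric])
  have "poly q (h u) \<in> range h" if "u \<in> S - {s}" for u
  proof -
    have "poly p (h u) = (h u - h s) * poly q (h u) + poly p (h s)"
      by (subst p) (simp add: algebra_simps)
    then have "poly q (h u) = (poly p (h u) - poly p (h s)) / (h u - h s)"
      using that by (simp add: field_simps)
    then show ?thesis using that s Suc by (auto intro!: range_divide range_diff)
  qed
  then have "q \<in> range (map_poly h)"
    using Suc.prems Suc.hyps(2) by (intro Suc.hyps(1)[of q "S - {s}"]) (auto simp: q_def degree_synthetic_div simp flip: Suc.hyps(2))
  moreover obtain c where "poly p (h s) = h c" using Suc s by blast
  ultimately obtain q0 c where q0: "q = map_poly h q0" and c: "poly p (h s) = h c" by blast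
  have "p = map_poly h ([:- s, 1:] * q0 + [:c:])" 
    by (subst p) (simp only: q0 c map_poly_add map_poly_mult map_poly_pCons' map_minus map_1 map_poly_0)
  then show ?case by blast
qed

text \<open>
  The coefficients of \<open>P\<close> are recovered from those of \<open>P\<^sup>2\<close> from the top down: if \<open>m\<close> is the degree
  of \<open>P\<close>, then the coefficient of \<open>P\<^sup>2\<close> at \<open>m + n\<close> is twice the coefficient of \<open>P\<close> at \<open>n\<close>, plus
  products of coefficients of \<open>P\<close> at larger indices.
\<close>

lemma monic_sqrt_range:
  assumes two: "(2::'b) \<noteq> 0" and monic: "lead_coeff P = 1"
    and sq: "P * P \<in> range (map_poly h)"
  shows "P \<in> range (map_poly h)"
proof (rule range_map_polyI)
  fix n
  define m where "m = degree P"
  have 1: "coeff P m = 1" using monic by (simp add: m_def)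
  have up: "coeff P i = 0" if "i > m" for i using that by (simp add: m_def coeff_eq_0)
  have r0: "0 \<in> range h" "1 \<in> range h" by (metis map_0 rangeI, metis map_1 rangeI)
  show "coeff P n \<in> range h"
  proof (induction "m - n" arbitrary: n rule: less_induct)
    case less
    consider "n > m" | "n = m" | "n < m" by linarith
    then show ?case
    proof cases
      case 3
      have IH: "coeff P i \<in> range h" if "n < i" for i
        using less[of i] that 3 by (cases "i \<le> m") (auto simp: up r0)
      have "coeff (P * P) (m + n) = (\<Sum>i\<le>m + n. coeff P i * coeff P (m + n - i))"
        by (rule coeff_mult)
      also have "\<dots> = (\<Sum>i\<in>{n..m}. coeff P i * coeff P (m + n - i))"
        by (rule sum.mono_neutral_right) (auto simp: up not_le)
      also have "{n..m} = insert n (insert m {n<..<m})" using 3 by auto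
      also have "(\<Sum>i\<in>\<dots>. coeff P i * coeff P (m + n - i)) =
          2 * coeff P n + (\<Sum>i\<in>{n<..<m}. coeff P i * coeff P (m + n - i))"
        using 3 1 by simp
      finally have eq: "coeff P n = (coeff (P * P) (m + n) -
          (\<Sum>i\<in>{n<..<m}. coeff P i * coeff P (m + n - i))) * inverse 2"
        using two by (simp add: field_simps)
      have "coeff (P * P) (m + n) \<in> range h" using sq by auto
      moreover have "(\<Sum>i\<in>{n<..<m}. coeff P i * coeff P (m + n - i)) \<in> range h"
        by (intro range_sum range_mult IH) auto
      moreover have "inverse 2 \<in> range h"
        by (intro range_inverse) (metis map_of_nat of_nat_numeral rangeI)
      ultimately show ?thesis unfolding eq by (intro range_mult range_diff)
    qed (auto simp: up r0 1)
  qed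
qed

end

section \<open>Symmetric products over the roots of a polynomial\<close>

lemma alg_closed_split:
  fixes p :: "'b::alg_closed_field poly"
  assumes "p \<noteq> 0"
  shows "\<exists>x. p = smult (lead_coeff p) (\<Prod>i<degree p. [:- x i, 1:])"
proof -
  obtain M where M: "size M = degree p" "p = smult (lead_coeff p) (\<Prod>x\<in>#M. [:-x, 1:])"
    using alg_closed_imp_factorization[OF assms] by blast
  obtain xs where xs: "M = mset xs" by (metis ex_mset)
  have "(\<Prod>x\<in>#M. [:-x, 1:]) = (\<Prod>i<length xs. [:- (xs ! i), 1:])"
    by (simp add: xs prod_mset_prod_list prod.list_conv_set_nth atLeast0LessThan flip: mset_map)
  then show ?thesis using M xs by (intro exI[of _ "\<lambda>i. xs ! i"]) simp
qed

lemma prod_square_symmetric: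
  fixes f :: "nat \<Rightarrow> nat \<Rightarrow> 'a::comm_ring_1"
  assumes "\<And>i j. f i j = f j i"
  shows "(\<Prod>i<n. \<Prod>j<n. f i j) = (\<Prod>i<n. f i i) * (\<Prod>j<n. \<Prod>i<j. f i j)\<^sup>2"
proof (induction n)
  case (Suc n)
  have "(\<Prod>i<Suc n. \<Prod>j<Suc n. f i j) =
      (\<Prod>i<n. \<Prod>j<n. f i j) * (\<Prod>i<n. f i n) * ((\<Prod>j<n. f n j) * f n n)"
    by (simp add: prod.distrib)
  also have "(\<Prod>j<n. f n j) = (\<Prod>i<n. f i n)" by (intro prod.cong refl assms)
  finally show ?case using Suc by (simp add: power2_eq_square algebra_simps)
qed simp

text \<open>
  The product is, up to a power of the leading coefficient, the resultant of \<open>p\<close> and \<open>g\<close>. It lies in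
  the base field by the Euclidean algorithm: \<open>g\<close> may be replaced by \<open>r = g mod p\<close>, which agrees
  with \<open>g\<close> at the roots of \<open>p\<close>. By factoring \<open>r\<close> as well, the product of \<open>r\<close> over the roots of \<open>p\<close>
  turns into the product of \<open>p\<close> over the roots of \<open>r\<close>, and \<open>r\<close> has smaller degree.
\<close>

lemma range_prod_roots:
  fixes h :: "'a::field \<Rightarrow> 'b::alg_closed_field"
  assumes "field_embedding h" "p \<noteq> 0"
    and "map_poly h p = smult (h (lead_coeff p)) (\<Prod>i<degree p. [:- x i, 1:])"
  shows "(\<Prod>i<degree p. poly (map_poly h g) (x i)) \<in> range h"
  using assms(2,3)
proof (induction "degree p" arbitrary: p g x rule: less_induct)
  case less
  interpret field_embedding h by fact
  define n where "n = degree p"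
  have p: "poly (map_poly h p) y = h (lead_coeff p) * (\<Prod>i<n. y - x i)" for y
    unfolding less.prems(2) by (simp add: poly_prod n_def)
  show ?case
  proof (cases "n = 0")
    case True
    then show ?thesis by (simp add: flip: n_def) (metis map_1 rangeI)
  next
    case n0: False
    define r where "r = g mod p"
    have g: "g = (g div p) * p + r" by (simp add: r_def)
    have gr: "poly (map_poly h g) (x i) = poly (map_poly h r) (x i)" if "i < n" for i
      by (subst g, use that in \<open>auto simp: p\<close>)
    show ?thesis
    proof (cases "r = 0")
      case True
      then have "(\<Prod>i<degree p. poly (map_poly h g) (x i)) = 0"
        using n0 gr by (simp add: n_def)
      then show ?thesis by (metis map_0 rangeI)
    next
      case r0: False
      define m where "m = degree r"
      have mn: "m < n" using r0 less.prems n0 unfolding m_def n_def r_def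
        by (metis degree_mod_less' )
      obtain y where "map_poly h r = smult (lead_coeff (map_poly h r)) (\<Prod>j<degree (map_poly h r). [:- y j, 1:])"
        using alg_closed_split[of "map_poly h r"] r0 by auto
      then have y: "map_poly h r = smult (h (lead_coeff r)) (\<Prod>j<degree r. [:- y j, 1:])"
        by simp
      have r: "poly (map_poly h r) z = h (lead_coeff r) * (\<Prod>j<m. z - y j)" for z
        unfolding y by (simp add: poly_prod m_def)
      \<comment> \<open>exchanging the roles of the roots of \<open>p\<close> and of \<open>r\<close> costs one sign per factor\<close>
      have flip: "(\<Prod>i<n. x i - y j) = (- 1) ^ n * inverse (h (lead_coeff p)) * poly (map_poly h p) (y j)" for j
      proof -
        have "(\<Prod>i<n. x i - y j) = (\<Prod>i<n. (- 1) * (y j - x i))" by simp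
        also have "\<dots> = (- 1) ^ n * (\<Prod>i<n. y j - x i)" by (simp only: prod.distrib prod_constant card_lessThan)
        finally show ?thesis using less.prems(1) by (simp add: p)
      qed
      have "(\<Prod>i<degree p. poly (map_poly h g) (x i)) = (\<Prod>i<n. h (lead_coeff r) * (\<Prod>j<m. x i - y j))"
        by (simp add: gr r flip: n_def)
      also have "\<dots> = h (lead_coeff r) ^ n * (\<Prod>j<m. \<Prod>i<n. x i - y j)"
        by (subst prod.swap) (simp add: prod.distrib)
      also have "\<dots> = h (lead_coeff r) ^ n * (((- 1) ^ n * inverse (h (lead_coeff p))) ^ m *
          (\<Prod>j<degree r. poly (map_poly h p) (y j)))"
        by (simp only: flip prod.distrib prod_constant card_lessThan power_mult_distrib flip: m_def)
      also have "\<dots> \<in> range h"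
        using less.hyps[of r y p] mn y r0
        by (intro range_mult range_power range_inverse)
          (auto simp: m_def n_def intro: range_eqI[of _ h "- 1"])
      finally show ?thesis .
    qed
  qed
qed

section \<open>Laplace's proof of the fundamental theorem of algebra\<close>

text \<open>
  The number of pairs of roots, which is the degree of the auxiliary polynomial in Laplace's
  argument, contains one factor 2 less than the number of roots, when the latter is even.
\<close>

lemma sum_lessThan_two_power:
  assumes n: "n = 2 ^ Suc k * m" and m: "odd (m::nat)"
  shows "\<exists>m'. (\<Sum>j<n. j) = 2 ^ k * m' \<and> odd m'"
proof -
  have *: "2 * (\<Sum>j<Suc n. j) = Suc n * n" for n :: nat
    by (induction n) auto
  have "n > 0" using n m by (cases m) auto
  then have "2 * (\<Sum>j<n. j) = n * (n - 1)"
    using *[of "n - 1"] by simp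
  then have "(\<Sum>j<n. j) = 2 ^ k * (m * (n - 1))" using n by simp
  moreover have "odd (m * (n - 1))" using m n \<open>n > 0\<close> by (cases n) auto
  ultimately show ?thesis by blast
qed

locale alg_closed_extension = field_embedding h
  for h :: "'a::field_char_0 \<Rightarrow> 'b::{alg_closed_field, field_char_0}"
begin

text \<open>
  Two applications of the resultant lemma: the inner product, as a polynomial \<open>G\<close> in \<open>y = x i\<close>, takes
  values in the base field at every \<open>y\<close> of the base field, so by interpolation its coefficients lie
  there; then the outer product is a product of values of \<open>G\<close> over the roots.
\<close>

lemma range_prod_pairs:
  assumes "p \<noteq> 0" "map_poly h p = smult (h (lead_coeff p)) (\<Prod>i<degree p. [:- x i, 1:])"
  shows "(\<Prod>i<degree p. \<Prod>j<degree p. h s - (x i + x j + h t * (x i * x j))) \<in> range h"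
proof -
  define G where "G = (\<Prod>j<degree p. [:h s - x j, - (1 + h t * x j):])"
  have "poly G (h v) \<in> range h" for v
  proof -
    have "poly G (h v) = (\<Prod>j<degree p. poly (map_poly h [:s - v, - (1 + t * v):]) (x j))"
      unfolding G_def poly_prod by (intro prod.cong) (auto simp: algebra_simps)
    also have "\<dots> \<in> range h"
      by (rule range_prod_roots) (use assms field_embedding_axioms in auto)
    finally show ?thesis .
  qed
  then have "G \<in> range (map_poly h)"
    using infinite_UNIV_char_0 by (intro interpolation_range[of UNIV]) auto
  then obtain g where g: "G = map_poly h g" by blast
  have "(\<Prod>i<degree p. \<Prod>j<degree p. h s - (x i + x j + h t * (x i * x j))) =
      (\<Prod>i<degree p. poly (map_poly h g) (x i))"
    unfolding g[symmetric] G_def poly_prod by (intro prod.cong) (auto simp: algebra_simps)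
  also have "\<dots> \<in> range h"
    by (rule range_prod_roots) (use assms field_embedding_axioms in auto)
  finally show ?thesis .
qed

text \<open>
  Over all ordered pairs of indices the product is known to be in the base field. It is the square
  of the product \<open>P\<close> over unordered pairs, times the product \<open>D\<close> over the diagonal, which is in the
  base field too. Dividing by \<open>D\<close> away from its finitely many zeros puts the values of \<open>P\<^sup>2\<close>, and
  hence its coefficients, into the base field; then \<open>P\<close> is treated as a monic square root.
\<close>

lemma pair_polynomial_range:
  assumes p: "p \<noteq> 0" "map_poly h p = smult (h (lead_coeff p)) (\<Prod>i<degree p. [:- x i, 1:])"
  shows "(\<Prod>j<degree p. \<Prod>i<j. [:- (x i + x j + h t * (x i * x j)), 1:]) \<in> range (map_poly h)"
    (is "?P \<in> _")
proof (rule monic_sqrt_range)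
  show "lead_coeff ?P = 1" by (simp add: lead_coeff_prod)
  define n where "n = degree p"
  define D where "D = (\<Prod>i<n. [:- (x i + x i + h t * (x i * x i)), 1:])"
  have D0: "D \<noteq> 0" unfolding D_def by (simp add: prod_zero_iff)
  have D: "poly D (h s) \<in> range h" for s
  proof -
    have "poly D (h s) = (\<Prod>i<degree p. poly (map_poly h [:s, - 2, - t:]) (x i))"
      unfolding D_def poly_prod n_def
      by (intro prod.cong) (auto simp: algebra_simps map_of_nat[of 2, simplified])
    also have "\<dots> \<in> range h"
      by (rule range_prod_roots) (use assms field_embedding_axioms in auto)
    finally show ?thesis .
  qed
  have "finite (h -` {z. poly D z = 0})"
    by (intro finite_vimageI poly_roots_finite D0) (simp add: inj_on_def)
  then have "infinite (- (h -` {z. poly D z = 0}))"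
    using infinite_UNIV_char_0 by (simp add: finite_compl)
  then have inf: "infinite {s. poly D (h s) \<noteq> 0}" by (simp add: vimage_def Compl_eq)
  show "?P * ?P \<in> range (map_poly h)"
  proof (rule interpolation_range[OF inf])
    fix s assume "s \<in> {s. poly D (h s) \<noteq> 0}"
    then have nz: "poly D (h s) \<noteq> 0" by simp
    define f where "f = (\<lambda>i j. h s - (x i + x j + h t * (x i * x j)))"
    have f: "poly [:- (x i + x j + h t * (x i * x j)), 1:] (h s) = f i j" for i j
      by (simp add: f_def)
    have "f i j = f j i" for i j by (simp add: f_def add.commute mult.commute)
    then have "(\<Prod>i<n. \<Prod>j<n. f i j) = (\<Prod>i<n. f i i) * (\<Prod>j<n. \<Prod>i<j. f i j)\<^sup>2"
      by (rule prod_square_symmetric)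
    also have "\<dots> = poly D (h s) * poly (?P * ?P) (h s)"
      unfolding D_def poly_prod f poly_mult power2_eq_square n_def ..
    finally have eq: "(\<Prod>i<n. \<Prod>j<n. h s - (x i + x j + h t * (x i * x j))) = poly D (h s) * poly (?P * ?P) (h s)"
      unfolding f_def .
    have quotient: "b = a / d" if "a = d * b" "d \<noteq> 0" for a b d :: 'b
      using that by simp
    from eq have "poly (?P * ?P) (h s) =
        (\<Prod>i<n. \<Prod>j<n. h s - (x i + x j + h t * (x i * x j))) / poly D (h s)"
      by (rule quotient[OF _ nz])
    also have "\<dots> \<in> range h"
      unfolding n_def by (intro range_divide D range_prod_pairs assms)
    finally show "poly (?P * ?P) (h s) \<in> range h" .
  qed
qed simp

text \<open>
  The difference \<open>u - v\<close> is a square root of the discriminant \<open>(u + v)\<^sup>2 - 4 u v\<close>, so closure under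
  square roots is what is needed to solve the quadratic equation for \<open>u\<close> and \<open>v\<close>.
\<close>

lemma root_from_sum_and_product:
  assumes F: "range h \<subseteq> F" "\<And>u v. u \<in> F \<Longrightarrow> v \<in> F \<Longrightarrow> u + v \<in> F"
    "\<And>u v. u \<in> F \<Longrightarrow> v \<in> F \<Longrightarrow> u * v \<in> F" "\<And>w. w * w \<in> F \<Longrightarrow> w \<in> F"
    and "u + v \<in> F" "u * v \<in> F"
  shows "u \<in> F"
proof -
  have hF: "h c \<in> F" for c using F(1) by blast
  have "(u - v) * (u - v) = (u + v) * (u + v) + h (- 4) * (u * v)"
    using map_of_nat[of 4] by (simp add: algebra_simps)
  also have "\<dots> \<in> F" by (rule F(2)[OF F(3)[OF assms(5,5)] F(3)[OF hF assms(6)]])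
  finally have "u - v \<in> F" by (rule F(4))
  then have "h (inverse 2) * ((u + v) + (u - v)) \<in> F" by (rule F(3)[OF hF F(2)[OF assms(5)]])
  moreover have "h (inverse 2) * ((u + v) + (u - v)) = u"
    using map_of_nat[of 2] unfolding map_inverse by simp
  ultimately show ?thesis by (simp only:)
qed

text \<open>
  Laplace's proof of the fundamental theorem of algebra, by induction on the exponent of 2 in the
  degree; polynomials of odd degree have a root by assumption. For every natural number \<open>t\<close> the
  polynomial whose roots are \<open>x\<^sub>i + x\<^sub>j + t x\<^sub>i x\<^sub>j\<close> for \<open>i < j\<close> has coefficients in the base field and a degree with a smaller
  exponent of 2, so one of these elements is in \<open>F\<close>. There are infinitely many \<open>t\<close> but only finitely
  many pairs, so some pair works for two values of \<open>t\<close>. This puts \<open>x\<^sub>i x\<^sub>j\<close> and \<open>x\<^sub>i + x\<^sub>j\<close> into \<open>F\<close>,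
  and then \<open>x\<^sub>i\<close> itself.
\<close>

theorem has_root_in_sqrt_closed:
  assumes F: "range h \<subseteq> F" "\<And>u v. u \<in> F \<Longrightarrow> v \<in> F \<Longrightarrow> u + v \<in> F"
    "\<And>u v. u \<in> F \<Longrightarrow> v \<in> F \<Longrightarrow> u * v \<in> F" "\<And>w. w * w \<in> F \<Longrightarrow> w \<in> F"
    and odd_root: "\<And>p :: 'a poly. odd (degree p) \<Longrightarrow> \<exists>x. poly p x = 0"
    and "degree p > 0"
  shows "\<exists>z\<in>F. poly (map_poly h p) z = 0"
proof -
  have hF: "h c \<in> F" for c using F(1) by blast
  have "\<exists>z\<in>F. poly (map_poly h p) z = 0" if "degree p = 2 ^ k * m" "odd m" for k m and p :: "'a poly"
    using that
  proof (induction k arbitrary: p m)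
    case 0
    then obtain x where "poly p x = 0" using odd_root[of p] by auto
    then show ?case by (intro bexI[of _ "h x"] hF) auto
  next
    case (Suc k)
    define n where "n = degree p"
    have p0: "p \<noteq> 0" using Suc.prems by (auto elim: oddE)
    then obtain x where x: "map_poly h p = smult (h (lead_coeff p)) (\<Prod>i<degree p. [:- x i, 1:])"
      using alg_closed_split[of "map_poly h p"] by auto
    have "\<exists>i j. i < n \<and> j < n \<and> x i + x j + h (of_nat t) * (x i * x j) \<in> F" for t :: nat
    proof -
      obtain P where P: "(\<Prod>j<n. \<Prod>i<j. [:- (x i + x j + h (of_nat t) * (x i * x j)), 1:]) = map_poly h P"
        using pair_polynomial_range[OF p0 x, of "of_nat t"] unfolding n_def by blast
      have "degree P = (\<Sum>j<n. j)"
        unfolding degree_map[of P, symmetric] P[symmetric]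
        by (subst degree_prod_eq_sum_degree) (auto simp: degree_prod_eq_sum_degree)
      then obtain m' where "degree P = 2 ^ k * m'" "odd m'"
        using sum_lessThan_two_power Suc.prems n_def by metis
      then obtain z where z: "z \<in> F" "poly (map_poly h P) z = 0" using Suc.IH by blast
      from z(2) obtain j i where "j < n" "i < j" "z = x i + x j + h (of_nat t) * (x i * x j)"
        unfolding P[symmetric] by (auto simp: poly_prod add_eq_0_iff)
      then show ?thesis using z(1) by (intro exI[of _ i] exI[of _ j]) auto
    qed
    then obtain I J where IJ: "\<And>t. I t < n" "\<And>t. J t < n"
      "\<And>t. x (I t) + x (J t) + h (of_nat t) * (x (I t) * x (J t)) \<in> F" by metis
    have "range (\<lambda>t. (I t, J t)) \<subseteq> {..<n} \<times> {..<n}" using IJ by auto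
    then have "finite (range (\<lambda>t. (I t, J t)))" by (rule finite_subset) simp
    then have "\<not> inj (\<lambda>t. (I t, J t))" using finite_imageD infinite_UNIV_nat by blast
    then obtain t u where tu: "t \<noteq> u" "I t = I u" "J t = J u" by (auto simp: inj_on_def)
    define a b where "a = x (I t)" and "b = x (J t)"
    have t: "a + b + h (of_nat t) * (a * b) \<in> F" and u: "a + b + h (of_nat u) * (a * b) \<in> F"
      using IJ(3)[of t] IJ(3)[of u] tu by (simp_all add: a_def b_def)
    have nz: "of_nat t - of_nat u \<noteq> (0::'b)" using tu by simp
    have "a * b = h (inverse (of_nat t - of_nat u)) *
        ((a + b + h (of_nat t) * (a * b)) + h (- 1) * (a + b + h (of_nat u) * (a * b)))"
      using nz unfolding map_inverse map_diff map_of_nat map_minus map_1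
      by (simp add: field_simps)
    also have "\<dots> \<in> F" by (rule F(3)[OF hF F(2)[OF t F(3)[OF hF u]]])
    finally have ab: "a * b \<in> F" .
    have "a + b = (a + b + h (of_nat t) * (a * b)) + h (- of_nat t) * (a * b)" by simp
    also have "\<dots> \<in> F" by (rule F(2)[OF t F(3)[OF hF ab]])
    finally have "a + b \<in> F" .
    then have "a \<in> F" using root_from_sum_and_product[OF F] ab by blast
    moreover have "poly (map_poly h p) a = 0"
      unfolding x using IJ(1)[of t] by (auto simp: poly_prod a_def n_def)
    ultimately show ?case by blast
  qed
  moreover obtain k m where "degree p = 2 ^ k * m" "odd m"
    by (rule multiplicity_decompose'[of "degree p" 2]) (use \<open>degree p > 0\<close> in auto)
  ultimately show ?thesis by blast
qed

end

section \<open>Polynomials over real closed fields: the intermediate value theorem\<close>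

text \<open>
  To apply Laplace's argument, the main point is that the elements \<open>a + \<iota> b\<close> are closed under square roots. As for
  the complex numbers, the real and imaginary part of a square root of \<open>a + \<iota> b\<close> are square roots of
  \<open>(r + a) / 2\<close> and \<open>(r - a) / 2\<close>, where \<open>r\<close> is the absolute value.
\<close>

lemma complex_root_of_real_closed:
  fixes p :: "'a::linordered_field poly"
  assumes rc: "real_closed TYPE('a)" and deg: "degree p > 0"
    and \<iota>: "\<iota> * \<iota> = (- 1 :: 'a alg_closure)"
  shows "\<exists>a b. poly (map_poly to_ac p) (to_ac a + \<iota> * to_ac b) = 0"
proof -
  interpret alg_closed_extension "to_ac :: 'a \<Rightarrow> 'a alg_closure"
    by unfold_locales simp_all
  \<comment> \<open>the field obtained by adjoining \<open>\<iota>\<close>\<close>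
  define F where "F = {to_ac a + \<iota> * to_ac b | a b. True}"
  have sqrt: "\<exists>y\<ge>0. y * y = x" if x: "x \<ge> 0" for x :: 'a
  proof -
    obtain y where "y * y = x" using rc x unfolding real_closed_def power2_eq_square by blast
    then show ?thesis by (intro exI[of _ "\<bar>y\<bar>"]) simp
  qed
  have "\<exists>z\<in>F. poly (map_poly to_ac p) z = 0"
  proof (rule has_root_in_sqrt_closed)
    show "range to_ac \<subseteq> F"
    proof
      fix u :: "'a alg_closure" assume "u \<in> range to_ac"
      then obtain a where "u = to_ac a + \<iota> * to_ac 0" by auto
      then show "u \<in> F" unfolding F_def by blast
    qed
  next
    fix u v assume "u \<in> F" "v \<in> F"
    then obtain a b c d where uv: "u = to_ac a + \<iota> * to_ac b" "v = to_ac c + \<iota> * to_ac d"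
      unfolding F_def by blast
    have "u + v = to_ac (a + c) + \<iota> * to_ac (b + d)"
      by (simp add: uv algebra_simps)
    then show "u + v \<in> F" unfolding F_def by blast
    have "u * v = to_ac (a * c) + (\<iota> * \<iota>) * to_ac (b * d) + \<iota> * to_ac (a * d + b * c)"
      by (simp add: uv algebra_simps)
    also have "\<dots> = to_ac (a * c - b * d) + \<iota> * to_ac (a * d + b * c)"
      unfolding \<iota> by simp
    finally show "u * v \<in> F" unfolding F_def by blast
  next
    fix w assume "w * w \<in> F"
    then obtain a b where w: "w * w = to_ac a + \<iota> * to_ac b"
      unfolding F_def by blast
    obtain r where r: "r \<ge> 0" "r * r = a * a + b * b"
      using sqrt[of "a * a + b * b"] by auto
    have "\<bar>a\<bar> \<le> r" by (rule power2_le_imp_le) (use r in \<open>auto simp: power2_eq_square\<close>)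
    then have "(r + a) / 2 \<ge> 0" "(r - a) / 2 \<ge> 0" by (auto simp: abs_le_iff)
    then obtain c d0 where c: "c \<ge> 0" "c * c = (r + a) / 2" and d0: "d0 \<ge> 0" "d0 * d0 = (r - a) / 2"
      using sqrt by meson
    have "(2 * c * d0) * (2 * c * d0) = 4 * (c * c) * (d0 * d0)" by simp
    also have "\<dots> = b * b" unfolding c d0 using r(2) by (simp add: field_simps)
    finally have "(2 * c * d0)\<^sup>2 = b\<^sup>2" by (simp add: power2_eq_square)
    then have "2 * c * d0 = b \<or> 2 * c * d0 = - b" by (simp only: power2_eq_iff)
    then obtain d where d: "2 * c * d = b" "d * d = (r - a) / 2"
      using d0(2) by (metis minus_mult_minus mult_minus_right minus_minus)
    have a: "a = c * c - d * d" using c d by (simp add: field_simps)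
    define z where "z = to_ac c + \<iota> * to_ac d"
    have "z * z = to_ac (c * c) + (\<iota> * \<iota>) * to_ac (d * d) + \<iota> * to_ac (2 * c * d)"
      by (simp add: z_def algebra_simps)
    also have "\<dots> = w * w" unfolding \<iota> w a d(1) by simp
    finally have "w = z \<or> w = - z" unfolding square_eq_iff by auto
    moreover have "- z = to_ac (- c) + \<iota> * to_ac (- d)" by (simp add: z_def)
    ultimately show "w \<in> F" unfolding F_def z_def by blast
  next
    fix q :: "'a poly" assume "odd (degree q)"
    then show "\<exists>x. poly q x = 0" using rc unfolding real_closed_def by blast
  qed (rule deg)
  then show ?thesis unfolding F_def by blast
qed

text \<open>
  A root \<open>a + \<iota> b\<close> with \<open>b \<noteq> 0\<close> is a zero of \<open>(X - a)\<^sup>2 + b\<^sup>2\<close>. The remainder of \<open>p\<close> modulo this quadratic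
  has degree at most 1 and vanishes at \<open>a + \<iota> b\<close>, which is not in the base field because \<open>-(b\<^sup>2)\<close> is not a square
  there; so the remainder is zero.
\<close>

lemma real_closed_factor:
  fixes p :: "'a::linordered_field poly"
  assumes rc: "real_closed TYPE('a)" and deg: "degree p > 0"
  shows "(\<exists>x. poly p x = 0) \<or> (\<exists>a b. b \<noteq> 0 \<and> [:a\<^sup>2 + b\<^sup>2, - (2 * a), 1:] dvd p)"
proof -
  interpret alg_closed_extension "to_ac :: 'a \<Rightarrow> 'a alg_closure"
    by unfold_locales simp_all
  obtain \<iota> :: "'a alg_closure" where \<iota>: "\<iota> * \<iota> = - 1"
    using nth_root_exists[of 2 "- 1 :: 'a alg_closure"] by (auto simp: power2_eq_square)
  then obtain a b where root: "poly (map_poly to_ac p) (to_ac a + \<iota> * to_ac b) = 0"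
    using complex_root_of_real_closed[OF rc deg] by blast
  define z where "z = to_ac a + \<iota> * to_ac b"
  show ?thesis
  proof (cases "b = 0")
    case True
    then show ?thesis using root by auto
  next
    case b: False
    define q where "q = [:a\<^sup>2 + b\<^sup>2, - (2 * a), 1:]"
    define r where "r = p mod q"
    have p: "p = p div q * q + r" by (simp add: r_def)
    have za: "(z - to_ac a) * (z - to_ac a) = - to_ac (b * b)"
      using \<iota> by (simp add: z_def algebra_simps) (simp flip: mult.assoc)
    have "poly (map_poly to_ac q) z = (z - to_ac a) * (z - to_ac a) + to_ac (b * b)"
      by (simp add: q_def algebra_simps power2_eq_square)
    then have q: "poly (map_poly to_ac q) z = 0" by (simp add: za)
    have "poly (map_poly to_ac p) z = poly (map_poly to_ac r) z"
      by (subst p) (simp add: q)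
    then have r: "poly (map_poly to_ac r) z = 0" using root by (simp add: z_def)
    have "r = 0"
    proof (rule ccontr)
      assume r0: "r \<noteq> 0"
      have "degree r < degree q"
        using degree_mod_less[of q p] r0 by (auto simp: r_def q_def)
      then have "degree r \<le> 1" by (simp add: q_def)
      then have vu: "r = [:coeff r 0, coeff r 1:]"
        by (intro poly_eqI) (auto simp: coeff_pCons coeff_eq_0 split: nat.split)
      define v u where "v = coeff r 0" and "u = coeff r 1"
      note vu = vu[folded v_def u_def]
      have lin: "to_ac v + z * to_ac u = 0" using r by (simp add: vu)
      have "u \<noteq> 0" using lin r0 by (auto simp: vu)
      then have "z = to_ac (- v / u)" using lin by (simp add: field_simps add_eq_0_iff)
      then have "to_ac ((- v / u - a) * (- v / u - a)) = to_ac (- (b * b))"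
        using za by simp
      then have "(- v / u - a) * (- v / u - a) + b * b = 0" unfolding map_eq_iff by simp
      then show False using b by (simp add: sum_squares_eq_zero_iff)
    qed
    then show ?thesis using b unfolding r_def q_def by (blast intro: mod_0_imp_dvd)
  qed
qed

text \<open>
  A factor \<open>(X - c)\<^sup>2 + d\<^sup>2\<close> is positive everywhere, and a factor \<open>X - x\<close> with \<open>x\<close> outside the interval has
  constant sign on it. Removing such factors preserves the change of sign and lowers the degree
  until a root inside the interval shows up.
\<close>

theorem real_closed_IVT:
  fixes p :: "'a::linordered_field poly"
  assumes rc: "real_closed TYPE('a)" and "a < b" "poly p a * poly p b < 0"
  shows "\<exists>x. a < x \<and> x < b \<and> poly p x = 0"
  using assms(3)
proof (induction "degree p" arbitrary: p rule: less_induct)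
  case less
  have "degree p > 0"
  proof (rule ccontr)
    assume "\<not> degree p > 0"
    then obtain c where "p = [:c:]" by (metis degree_eq_zeroE neq0_conv)
    then show False using less.prems by (simp add: mult_less_0_iff)
  qed
  have p0: "p \<noteq> 0" using less.prems by auto
  consider x where "poly p x = 0" | c d where "d \<noteq> 0" "[:c\<^sup>2 + d\<^sup>2, - (2 * c), 1:] dvd p"
    using real_closed_factor[OF rc \<open>degree p > 0\<close>] by blast
  then show ?case
  proof cases
    case 1
    then obtain q where q: "p = [:- x, 1:] * q" unfolding poly_eq_0_iff_dvd by (elim dvdE)
    show ?thesis
    proof (cases "a < x \<and> x < b")
      case False
      have eq: "poly p a * poly p b = ((a - x) * (b - x)) * (poly q a * poly q b)"
        by (simp add: q algebra_simps)
      have "(a - x) * (b - x) \<ge> 0"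
        using False \<open>a < b\<close> by (auto simp: zero_le_mult_iff)
      then have "poly q a * poly q b < 0"
        using less.prems unfolding eq by (auto simp: mult_less_0_iff[of "(a - x) * (b - x)"])
      moreover have "degree p = Suc (degree q)"
        using p0 unfolding q by (subst degree_mult_eq) auto
      ultimately obtain y where "a < y" "y < b" "poly q y = 0"
        using less.hyps[of q] by auto
      then show ?thesis by (auto simp: q)
    qed (use 1 in blast)
  next
    case 2
    then obtain q where q: "p = [:c\<^sup>2 + d\<^sup>2, - (2 * c), 1:] * q" by (elim dvdE)
    have ev: "poly [:c\<^sup>2 + d\<^sup>2, - (2 * c), 1:] y = (y - c)\<^sup>2 + d\<^sup>2" for y
      by (simp add: power2_eq_square algebra_simps)
    have pos: "(y - c)\<^sup>2 + d\<^sup>2 > 0" for y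
      using 2 by (simp add: add_nonneg_pos)
    have eq: "poly p y = ((y - c)\<^sup>2 + d\<^sup>2) * poly q y" for y
      unfolding q poly_mult ev ..
    have "poly q a * poly q b < 0"
      using less.prems pos[of a] pos[of b] unfolding eq by (auto simp: mult_less_0_iff zero_less_mult_iff)
    moreover have "degree p = Suc (Suc (degree q))"
      using p0 unfolding q by (subst degree_mult_eq) auto
    ultimately obtain y where "a < y" "y < b" "poly q y = 0"
      using less.hyps[of q] by auto
    then show ?thesis by (auto simp: q)
  qed
qed

section \<open>Rolle's theorem, the mean value theorem and continuity\<close>

lemma pderiv_two_powers:
  fixes A B r :: "'a::idom poly"
  assumes "pderiv A = 1" "pderiv B = 1" "m > 0" "n > 0"
  shows "pderiv (A ^ m * (B ^ n * r)) =
    A ^ (m - 1) * B ^ (n - 1) * (smult (of_nat m) (B * r) + smult (of_nat n) (A * r) + A * B * pderiv r)"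
proof -
  obtain m' n' where mn: "m = Suc m'" "n = Suc n'" using assms(3,4) by (metis gr0_implies_Suc)
  show ?thesis unfolding mn pderiv_mult pderiv_power_Suc assms(1,2)
    by (simp add: algebra_simps)
qed

text \<open>
  Take \<open>c\<close> to be the first root after \<open>a\<close> and split off the full powers of \<open>X - a\<close> and \<open>X - c\<close> from \<open>p\<close>.
  The cofactor \<open>r\<close> has the same sign at \<open>a\<close> and \<open>c\<close>. In the derivative, the cofactor \<open>g\<close> of the
  remaining powers reduces at \<open>a\<close> and at \<open>c\<close> to a single term each, and these have opposite signs.
\<close>

lemma real_closed_Rolle:
  fixes p :: "'a::linordered_field poly"
  assumes rc: "real_closed TYPE('a)" and "a < b" "poly p a = 0" "poly p b = 0"
  shows "\<exists>x. a < x \<and> x < b \<and> poly (pderiv p) x = 0"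
proof (cases "p = 0")
  case True
  then show ?thesis using \<open>a < b\<close> dense by auto
next
  case p0: False
  define S where "S = {x. a < x \<and> x \<le> b \<and> poly p x = 0}"
  have "finite S" using poly_roots_finite[OF p0] by (rule rev_finite_subset) (auto simp: S_def)
  moreover have "b \<in> S" using assms by (simp add: S_def)
  ultimately have MS: "Min S \<in> S" and Mle: "\<And>x. x \<in> S \<Longrightarrow> Min S \<le> x"
    by (auto intro: Min_in)
  define c where "c = Min S"
  have c: "a < c" "c \<le> b" "poly p c = 0" using MS by (auto simp: S_def c_def)
  have none: "poly p x \<noteq> 0" if "a < x" "x < c" for x
    using Mle[of x] that c by (auto simp: S_def c_def)
  define m where "m = order a p"
  obtain q where q: "p = [:- a, 1:] ^ m * q" "\<not> [:- a, 1:] dvd q"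
    using order_decomp[OF p0] unfolding m_def by blast
  have q0: "q \<noteq> 0" using q(2) by auto
  define n where "n = order c q"
  obtain r where r: "q = [:- c, 1:] ^ n * r" "\<not> [:- c, 1:] dvd r"
    using order_decomp[OF q0] unfolding n_def by blast
  have ra: "poly r a \<noteq> 0" using q(2) unfolding r by (auto simp: poly_eq_0_iff_dvd intro: dvd_mult)
  have rc0: "poly r c \<noteq> 0" using r(2) by (simp add: poly_eq_0_iff_dvd)
  have "m \<noteq> 0" unfolding m_def using p0 assms(3) by (simp add: order_root)
  have "n \<noteq> 0"
    using c(1,3) rc0 by (cases "n = 0") (auto simp: q r)
  have rac: "poly r a * poly r c > 0"
  proof (rule ccontr)
    assume "\<not> ?thesis"
    then have "poly r a * poly r c < 0" using ra rc0 by (simp add: not_less order_le_less)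
    then obtain x where "a < x" "x < c" "poly r x = 0"
      using real_closed_IVT[OF rc c(1)] by blast
    then show False using none[of x] by (simp add: q r)
  qed
  define g where "g = smult (of_nat m) ([:- c, 1:] * r) + smult (of_nat n) ([:- a, 1:] * r)
    + [:- a, 1:] * [:- c, 1:] * pderiv r"
  have pd: "pderiv p = [:- a, 1:] ^ (m - 1) * [:- c, 1:] ^ (n - 1) * g"
    unfolding q(1) r(1) g_def using \<open>m \<noteq> 0\<close> \<open>n \<noteq> 0\<close>
    by (intro pderiv_two_powers) (auto simp: pderiv_pCons)
  have "poly g a * poly g c = (of_nat m * of_nat n) * (- ((c - a) * (c - a))) * (poly r a * poly r c)"
    by (simp add: g_def algebra_simps)
  also have "\<dots> < 0"
    using rac c(1) \<open>m \<noteq> 0\<close> \<open>n \<noteq> 0\<close> by (simp add: mult_less_0_iff zero_less_mult_iff)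
  finally obtain x where "a < x" "x < c" "poly g x = 0"
    using real_closed_IVT[OF rc c(1)] by blast
  then show ?thesis using c(2) unfolding pd by auto
qed

lemma real_closed_MVT:
  fixes p :: "'a::linordered_field poly"
  assumes rc: "real_closed TYPE('a)" and "a < b"
  shows "\<exists>x. a < x \<and> x < b \<and> poly p b - poly p a = (b - a) * poly (pderiv p) x"
proof -
  \<comment> \<open>Rolle's theorem applied to the difference of \<open>p\<close> and the secant\<close>
  define k where "k = (poly p b - poly p a) / (b - a)"
  have k: "(b - a) * k = poly p b - poly p a" using \<open>a < b\<close> by (simp add: k_def)
  define q where "q = p - [:poly p a - k * a, k:]"
  have "poly q a = 0" by (simp add: q_def algebra_simps)
  moreover have "poly q b = 0" using k by (simp add: q_def algebra_simps)
  ultimately obtain x where x: "a < x" "x < b" "poly (pderiv q) x = 0"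
    using real_closed_Rolle[OF rc \<open>a < b\<close>] by blast
  have "poly (pderiv p) x = k"
    using x(3) by (simp add: q_def pderiv_diff pderiv_pCons)
  then show ?thesis using x k by auto
qed

lemma poly_bounded_near:
  fixes p :: "'a::linordered_field poly"
  shows "\<exists>M. \<forall>x. \<bar>x - r\<bar> \<le> 1 \<longrightarrow> \<bar>poly p x\<bar> \<le> M"
proof (induction p)
  case (pCons c p)
  then obtain M where M: "\<And>x. \<bar>x - r\<bar> \<le> 1 \<Longrightarrow> \<bar>poly p x\<bar> \<le> M" by blast
  have "\<bar>poly (pCons c p) x\<bar> \<le> \<bar>c\<bar> + (\<bar>r\<bar> + 1) * M" if "\<bar>x - r\<bar> \<le> 1" for x
  proof -
    have "\<bar>x\<bar> \<le> \<bar>r\<bar> + 1" using that by linarith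
    then have "\<bar>x\<bar> * \<bar>poly p x\<bar> \<le> (\<bar>r\<bar> + 1) * M" using M[OF that] by (intro mult_mono) auto
    then show ?thesis using abs_triangle_ineq[of c "x * poly p x"] by (simp add: abs_mult)
  qed
  then show ?case by blast
qed auto

lemma poly_continuous_at:
  fixes p :: "'a::linordered_field poly"
  assumes "\<epsilon> > 0"
  shows "\<exists>\<delta>>0. \<forall>x. \<bar>x - r\<bar> < \<delta> \<longrightarrow> \<bar>poly p x - poly p r\<bar> < \<epsilon>"
proof -
  define q where "q = synthetic_div p r"
  have "[:- r, 1:] * q + [:poly p r:] = p" unfolding q_def by (rule synthetic_div_correct')
  then have "poly p x = poly ([:- r, 1:] * q + [:poly p r:]) x" for x by simp
  then have q: "poly p x - poly p r = (x - r) * poly q x" for x by (simp add: algebra_simps)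
  obtain M where M: "\<And>x. \<bar>x - r\<bar> \<le> 1 \<Longrightarrow> \<bar>poly q x\<bar> \<le> M" using poly_bounded_near by blast
  have M0: "M \<ge> 0" using M[of r] by simp
  define \<delta> where "\<delta> = min 1 (\<epsilon> / (M + 1))"
  have "\<bar>poly p x - poly p r\<bar> < \<epsilon>" if x: "\<bar>x - r\<bar> < \<delta>" for x
  proof -
    have "\<bar>x - r\<bar> * \<bar>poly q x\<bar> \<le> \<bar>x - r\<bar> * M"
      using x by (intro mult_left_mono M) (auto simp: \<delta>_def)
    also have "\<dots> \<le> \<bar>x - r\<bar> * (M + 1)" by (simp add: mult_left_mono)
    also have "\<dots> < \<epsilon> / (M + 1) * (M + 1)"
      using x M0 by (intro mult_strict_right_mono) (auto simp: \<delta>_def)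
    also have "\<dots> = \<epsilon>" using M0 by simp
    finally show ?thesis by (simp add: q abs_mult)
  qed
  moreover have "\<delta> > 0" using assms M0 by (simp add: \<delta>_def)
  ultimately show ?thesis by blast
qed

section \<open>The approximate intermediate value theorem as a first-order scheme\<close>

lemma finite_term_vars: "finite (term_vars t)"
  by (induction t) auto

lemma finite_free_vars: "finite (free_vars \<phi>)"
  by (induction \<phi>) (auto simp: finite_term_vars)

lemma models_Forall: "models K (Forall n \<phi>) \<longleftrightarrow> models K \<phi>"
  unfolding models_def satisfies.simps by (metis fun_upd_triv)

text \<open>
  Since \<^const>\<open>models\<close> already quantifies over all assignments, it does not change under universal
  closure, so elementary equivalence also applies to formulas with free variables.
\<close>

lemma elementarily_equivalent_models:
  assumes "elementarily_equivalent K L"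
  shows "models K \<phi> \<longleftrightarrow> models L \<phi>"
proof -
  have "models K \<phi> \<longleftrightarrow> models L \<phi>" if "finite A" "free_vars \<phi> \<subseteq> A" for A
    using that
  proof (induction A arbitrary: \<phi>)
    case empty
    then show ?case using assms by (simp add: elementarily_equivalent_def is_sentence_def)
  next
    case (insert n A)
    then have "models K (Forall n \<phi>) \<longleftrightarrow> models L (Forall n \<phi>)"
      by (intro insert.IH) auto
    then show ?case unfolding models_Forall .
  qed
  then show ?thesis using finite_free_vars by blast
qed

primrec horner_term :: "or_term \<Rightarrow> nat list \<Rightarrow> or_term" where
  "horner_term t [] = Zero"
| "horner_term t (n # ns) = Plus (Var n) (Times t (horner_term t ns))"

lemma term_val_horner_term:
  "term_val e (horner_term t ns) = poly (Poly (map e ns)) (term_val e t)"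
  by (induction ns) auto

text \<open>
  The formula for polynomials with at most \<open>d\<close> coefficients. Variables 0 and 1 are the endpoints of
  the interval, 2 is the tolerance, 3 is the approximate root, and the coefficients, lowest degree
  first, are the variables from 4 on. Everything but variable 3 is left free.
\<close>

definition approximate_IVT_formula :: "nat \<Rightarrow> or_formula" where
  "approximate_IVT_formula d =
    (let p = (\<lambda>t. horner_term t [4..<4 + d]) in
      Impl (Conj (Conj (Less (Var 0) (Var 1)) (Less Zero (Var 2)))
                 (Conj (Less (p (Var 0)) Zero) (Less Zero (p (Var 1)))))
           (Exists 3 (Conj (Conj (Less (Var 0) (Var 3)) (Less (Var 3) (Var 1)))
                 (Conj (Less (Minus Zero (Var 2)) (p (Var 3))) (Less (p (Var 3)) (Var 2))))))"

text \<open>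
  The intermediate value theorem for \<open>p\<close>, up to arbitrarily small errors in the value. Unlike density
  it does not mention the real closure, and for polynomials of bounded degree it quantifies over
  elements of the field only, so it is expressible by a first-order formula.
\<close>

definition approximate_IVT :: "'a::linordered_field poly \<Rightarrow> bool" where
  "approximate_IVT p \<longleftrightarrow> (\<forall>a b \<epsilon>. a < b \<and> 0 < \<epsilon> \<and> poly p a < 0 \<and> 0 < poly p b \<longrightarrow>
     (\<exists>c. a < c \<and> c < b \<and> \<bar>poly p c\<bar> < \<epsilon>))"

lemma satisfies_approximate_IVT_formula:
  "satisfies e (approximate_IVT_formula d) \<longleftrightarrow>
    (let p = Poly (map e [4..<4 + d]) in
      e 0 < e 1 \<and> 0 < e 2 \<and> poly p (e 0) < 0 \<and> 0 < poly p (e 1) \<longrightarrow>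
      (\<exists>c. e 0 < c \<and> c < e 1 \<and> \<bar>poly p c\<bar> < e 2))"
proof -
  have "map (e(3 := c)) [4..<4 + d] = map e [4..<4 + d]" for c
    by (intro map_cong) auto
  then show ?thesis
    by (simp add: approximate_IVT_formula_def Let_def term_val_horner_term abs_less_iff
        minus_less_iff conj_ac del: upt_Suc)
qed

lemma models_approximate_IVT:
  fixes K :: "'a::linordered_field itself"
  shows "(\<forall>d. models K (approximate_IVT_formula d)) \<longleftrightarrow> (\<forall>p :: 'a poly. approximate_IVT p)"
proof (intro iffI allI)
  fix p :: "'a poly"
  assume models: "\<forall>d. models K (approximate_IVT_formula d)"
  show "approximate_IVT p"
    unfolding approximate_IVT_def
  proof (intro allI)
    fix a b \<epsilon> :: 'a
    define e where "e = (\<lambda>k. if k = 0 then a else if k = 1 then b else if k = 2 then \<epsilon>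
      else coeffs p ! (k - 4))"
    have "map e [4..<4 + length (coeffs p)] = coeffs p"
      by (intro nth_equalityI) (auto simp: e_def)
    then have "Poly (map e [4..<4 + length (coeffs p)]) = p" by simp
    moreover have "satisfies e (approximate_IVT_formula (length (coeffs p)))"
      using models unfolding models_def by blast
    moreover have "e 0 = a" "e 1 = b" "e 2 = \<epsilon>" by (simp_all add: e_def)
    ultimately show "a < b \<and> 0 < \<epsilon> \<and> poly p a < 0 \<and> 0 < poly p b \<longrightarrow>
        (\<exists>c. a < c \<and> c < b \<and> \<bar>poly p c\<bar> < \<epsilon>)"
      unfolding satisfies_approximate_IVT_formula Let_def by simp
  qed
next
  fix d
  assume "\<forall>p :: 'a poly. approximate_IVT p"
  then show "models K (approximate_IVT_formula d)"
    unfolding models_def satisfies_approximate_IVT_formula approximate_IVT_def Let_def by blast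
qed

section \<open>Density in a real closed field and the approximate intermediate value theorem\<close>

locale ordered_embedding = field_embedding j
  for j :: "'a::linordered_field \<Rightarrow> 'b::linordered_field" +
  assumes strict_mono: "strict_mono j"
begin

lemma map_less_iff [simp]: "j x < j y \<longleftrightarrow> x < y"
  by (rule strict_mono_less[OF strict_mono])

lemma map_le_iff [simp]: "j x \<le> j y \<longleftrightarrow> x \<le> y"
  by (rule strict_mono_less_eq[OF strict_mono])

lemma map_pos_iff [simp]: "0 < j x \<longleftrightarrow> 0 < x"
  using map_less_iff[of 0 x] by simp

lemma map_neg_iff [simp]: "j x < 0 \<longleftrightarrow> x < 0"
  using map_less_iff[of x 0] by simp

lemma map_abs [simp]: "j \<bar>x\<bar> = \<bar>j x\<bar>"
  using map_less_iff[of x 0] by (simp add: abs_if)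

text \<open>
  The polynomial has a genuine root in the real closed field, and by continuity its values are small
  at all nearby points of the dense subfield.
\<close>

lemma dense_imp_approximate_IVT:
  fixes p :: "'a poly"
  assumes rc: "real_closed TYPE('b)" and dense: "dense_via j"
  shows "approximate_IVT p"
  unfolding approximate_IVT_def
proof (intro allI impI)
  fix a b \<epsilon> :: 'a
  assume *: "a < b \<and> 0 < \<epsilon> \<and> poly p a < 0 \<and> 0 < poly p b"
  define P where "P = map_poly j p"
  have "poly P (j a) < 0" "0 < poly P (j b)"
    using * by (simp_all add: P_def)
  then have "poly P (j a) * poly P (j b) < 0" by (simp add: mult_neg_pos)
  then obtain r where r: "j a < r" "r < j b" "poly P r = 0"
    using real_closed_IVT[OF rc, of "j a" "j b" P] * by auto
  obtain \<delta> where \<delta>: "\<delta> > 0" "\<And>x. \<bar>x - r\<bar> < \<delta> \<Longrightarrow> \<bar>poly P x - poly P r\<bar> < j \<epsilon>"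
    using poly_continuous_at[of "j \<epsilon>" r P] * by auto
  have "max (j a) (r - \<delta>) < min (j b) (r + \<delta>)" using * r \<delta> by auto
  then obtain c where c: "max (j a) (r - \<delta>) < j c" "j c < min (j b) (r + \<delta>)"
    using dense unfolding dense_via_def by blast
  have "\<bar>j c - r\<bar> < \<delta>" using c by (auto simp: abs_less_iff)
  then have "\<bar>poly P (j c)\<bar> < j \<epsilon>" using \<delta>(2) r(3) by simp
  then have "\<bar>poly p c\<bar> < \<epsilon>" unfolding P_def poly_map_poly by (simp flip: map_abs)
  then show "\<exists>c. a < c \<and> c < b \<and> \<bar>poly p c\<bar> < \<epsilon>" using c by auto
qed

text \<open>
  A form of the Cauchy bound on roots that is convenient for induction on the polynomial: bounds
  \<open>M\<close> and \<open>m\<close> in the smaller field, uniform in the argument from the larger one.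
\<close>

lemma poly_bounded_below_far_out:
  assumes "p \<noteq> 0"
  shows "\<exists>M m. m > 0 \<and> (\<forall>x. j M \<le> \<bar>x\<bar> \<longrightarrow> j m \<le> \<bar>poly (map_poly j p) x\<bar>)"
  using assms
proof (induction p)
  case (pCons a p)
  show ?case
  proof (cases "p = 0")
    case True
    then show ?thesis using pCons by (intro exI[of _ 0] exI[of _ "\<bar>a\<bar>"]) auto
  next
    case False
    then obtain M m where Mm: "m > 0" "\<And>x. j M \<le> \<bar>x\<bar> \<Longrightarrow> j m \<le> \<bar>poly (map_poly j p) x\<bar>"
      using pCons by blast
    \<comment> \<open>beyond \<open>N\<close> the product \<open>\<bar>x\<bar> m\<close> exceeds \<open>\<bar>a\<bar>\<close> by at least 1, which absorbs the constant term \<open>a\<close>\<close>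
    define N where "N = max M ((\<bar>a\<bar> + 1) / m)"
    have "j 1 \<le> \<bar>poly (map_poly j (pCons a p)) x\<bar>" if x: "j N \<le> \<bar>x\<bar>" for x
    proof -
      have "j ((\<bar>a\<bar> + 1) / m) \<le> j N" "j M \<le> j N" by (simp_all only: map_le_iff N_def max.cobounded1 max.cobounded2)
      then have 1: "j ((\<bar>a\<bar> + 1) / m) \<le> \<bar>x\<bar>" "j M \<le> \<bar>x\<bar>" using x by linarith+
      have "\<bar>a\<bar> + 1 = (\<bar>a\<bar> + 1) / m * m" using Mm(1) by simp
      then have "j (\<bar>a\<bar> + 1) = j ((\<bar>a\<bar> + 1) / m) * j m" by (metis map_mult)
      also have "\<dots> \<le> \<bar>x\<bar> * \<bar>poly (map_poly j p) x\<bar>"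
        using 1(1) Mm(2)[OF 1(2)] map_le_iff[of 0 m] Mm(1) by (intro mult_mono) auto
      finally have "\<bar>j a\<bar> + 1 \<le> \<bar>x * poly (map_poly j p) x\<bar>" by (simp add: abs_mult)
      then show ?thesis using abs_triangle_ineq4[of "j a + x * poly (map_poly j p) x" "j a"] by simp
    qed
    then show ?thesis by (intro exI[of _ N] exI[of _ 1]) auto
  qed
qed simp

lemma algebraic_imp_bounded:
  assumes "algebraic_via j x"
  shows "\<exists>M. \<bar>x\<bar> < j M"
proof -
  obtain p where "p \<noteq> 0" "poly (map_poly j p) x = 0"
    using assms unfolding algebraic_via_def by blast
  then show ?thesis
    using poly_bounded_below_far_out[of p] by (metis abs_zero map_pos_iff not_le)
qed

lemma algebraic_imp_coinitial:
  assumes alg: "\<And>x. algebraic_via j x" and "\<epsilon> > 0"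
  shows "\<exists>\<delta>>0. j \<delta> < \<epsilon>"
proof -
  obtain M where M: "\<bar>inverse \<epsilon>\<bar> < j M" using algebraic_imp_bounded[OF alg] by blast
  then have 1: "inverse \<epsilon> < j M" using \<open>\<epsilon> > 0\<close> by simp
  have "0 < j M" using 1 by (rule less_trans[rotated]) (use \<open>\<epsilon> > 0\<close> in simp)
  have "inverse (j M) < \<epsilon>" using 1 \<open>\<epsilon> > 0\<close>
    by (metis inverse_inverse_eq inverse_less_imp_less inverse_positive_iff_positive less_imp_inverse_less)
  then show ?thesis using \<open>0 < j M\<close> by (intro exI[of _ "inverse M"]) simp
qed

definition approximable :: "'b \<Rightarrow> bool" where
  "approximable x \<longleftrightarrow> (\<forall>\<epsilon>>0. \<exists>c. \<bar>x - j c\<bar> < \<epsilon>)"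

lemma approximable_minus: "approximable x \<Longrightarrow> approximable (- x)"
  unfolding approximable_def
proof (intro allI impI)
  fix \<epsilon> :: 'b assume "\<forall>\<epsilon>>0. \<exists>c. \<bar>x - j c\<bar> < \<epsilon>" "\<epsilon> > 0"
  then obtain c where "\<bar>x - j c\<bar> < \<epsilon>" by blast
  then have "\<bar>- x - j (- c)\<bar> < \<epsilon>" by (simp add: abs_minus_commute)
  then show "\<exists>c. \<bar>- x - j c\<bar> < \<epsilon>" by blast
qed

text \<open>
  Move an approximation of \<open>\<beta>\<close> to the right by its maximal error; with an error of less than half the
  distance it stays on the left of \<open>\<alpha>\<close>.
\<close>

lemma separate_approximable:
  assumes alg: "\<And>x. algebraic_via j x" and "approximable \<beta>" "\<beta> < \<alpha>"
  shows "\<exists>c. \<beta> < j c \<and> j c < \<alpha>"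
proof -
  obtain \<delta> where \<delta>: "\<delta> > 0" "j \<delta> < (\<alpha> - \<beta>) / 2"
    using algebraic_imp_coinitial[OF alg, of "(\<alpha> - \<beta>) / 2"] \<open>\<beta> < \<alpha>\<close> by auto
  then obtain c where c: "\<bar>\<beta> - j c\<bar> < j \<delta>"
    using assms(2) unfolding approximable_def by (meson map_pos_iff)
  have "\<beta> < j (c + \<delta>)" using c by (simp add: abs_less_iff)
  moreover have "2 * j \<delta> < \<alpha> - \<beta>" using \<delta> by simp
  then have "j (c + \<delta>) < \<alpha>" using c by (simp add: abs_less_iff)
  ultimately show ?thesis by blast
qed

lemma separate_finite_left:
  assumes alg: "\<And>x. algebraic_via j x" and "finite S" "\<And>s. s \<in> S \<Longrightarrow> approximable s"
  shows "\<exists>a. j a < \<alpha> \<and> (\<forall>s\<in>S. s < \<alpha> \<longrightarrow> s < j a)"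
  using assms(2,3)
proof (induction S)
  case empty
  obtain M where "\<bar>\<alpha>\<bar> < j M" using algebraic_imp_bounded[OF alg] by blast
  then have "j (- M) < \<alpha>" by (simp add: abs_less_iff minus_less_iff)
  then show ?case by blast
next
  case (insert s S)
  then obtain a where a: "j a < \<alpha>" "\<forall>s\<in>S. s < \<alpha> \<longrightarrow> s < j a" by blast
  show ?case
  proof (cases "s < \<alpha>")
    case True
    then obtain c where c: "s < j c" "j c < \<alpha>"
      using separate_approximable[OF alg] insert.prems by blast
    have "j (max a c) = max (j a) (j c)" by (auto simp: max_def)
    then show ?thesis using a c by (intro exI[of _ "max a c"]) auto
  qed (use a in blast)
qed

lemma separate_finite_right:
  assumes alg: "\<And>x. algebraic_via j x" and "finite S" "\<And>s. s \<in> S \<Longrightarrow> approximable s"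
  shows "\<exists>b. \<alpha> < j b \<and> (\<forall>s\<in>S. \<alpha> < s \<longrightarrow> j b < s)"
proof -
  have "\<exists>a. j a < - \<alpha> \<and> (\<forall>s\<in>uminus ` S. s < - \<alpha> \<longrightarrow> s < j a)"
    using assms by (intro separate_finite_left) (auto intro: approximable_minus)
  then obtain a where "j a < - \<alpha>" "\<forall>s\<in>S. - s < - \<alpha> \<longrightarrow> - s < j a" by blast
  then show ?thesis by (intro exI[of _ "- a"]) (auto simp: minus_less_iff less_minus_iff)
qed

text \<open>
  As the critical points of \<open>p\<close> are approximable, they can be separated from \<open>\<alpha>\<close> by elements \<open>a\<close>
  and \<open>b\<close> of the smaller field. Between these \<open>p\<close> is strictly increasing, so it changes sign, and a
  point \<open>c\<close> where \<open>p\<close> takes a sufficiently small value must be close to \<open>\<alpha>\<close>.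
\<close>

lemma simple_root_approximable:
  assumes rc: "real_closed TYPE('b)" and alg: "\<And>x. algebraic_via j x"
    and ivt: "approximate_IVT p"
    and root: "poly (map_poly j p) \<alpha> = 0"
    and deriv: "poly (pderiv (map_poly j p)) \<alpha> > 0"
    and critical: "\<And>x. poly (pderiv (map_poly j p)) x = 0 \<Longrightarrow> approximable x"
  shows "approximable \<alpha>"
  unfolding approximable_def
proof (intro allI impI)
  fix \<epsilon> :: 'b assume "\<epsilon> > 0"
  define P where "P = map_poly j p"
  define S where "S = {x. poly (pderiv P) x = 0}"
  have "pderiv P \<noteq> 0" using deriv by (auto simp: P_def)
  then have S: "finite S" "\<And>s. s \<in> S \<Longrightarrow> approximable s" "\<alpha> \<notin> S"
    using poly_roots_finite critical deriv by (auto simp: S_def P_def)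
  obtain a where a: "j a < \<alpha>" "\<And>s. s \<in> S \<Longrightarrow> s < \<alpha> \<Longrightarrow> s < j a"
    using separate_finite_left[OF alg S(1,2)] by blast
  obtain b where b: "\<alpha> < j b" "\<And>s. s \<in> S \<Longrightarrow> \<alpha> < s \<Longrightarrow> j b < s"
    using separate_finite_right[OF alg S(1,2)] by blast
  have no_critical: "poly (pderiv P) x \<noteq> 0" if "j a \<le> x" "x \<le> j b" for x
  proof
    assume "poly (pderiv P) x = 0"
    then have "x \<in> S" by (simp add: S_def)
    then show False using that a(2)[of x] b(2)[of x] S(3) by (cases x \<alpha> rule: linorder_cases) auto
  qed
  have pos: "poly (pderiv P) x > 0" if x: "j a \<le> x" "x \<le> j b" for x
  proof (rule ccontr)
    assume "\<not> ?thesis"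
    then have neg: "poly (pderiv P) x < 0" using no_critical[OF x] by auto
    have d: "poly (pderiv P) \<alpha> > 0" using deriv by (simp add: P_def)
    consider "x < \<alpha>" | "x = \<alpha>" | "\<alpha> < x" by linarith
    then show False
    proof cases
      case 1
      then obtain y where "x < y" "y < \<alpha>" "poly (pderiv P) y = 0"
        using real_closed_IVT[OF rc 1, of "pderiv P"] neg d by (auto simp: mult_neg_pos)
      then show False using no_critical[of y] x b(1) by simp
    next
      case 2
      then show False using neg d by simp
    next
      case 3
      then obtain y where "\<alpha> < y" "y < x" "poly (pderiv P) y = 0"
        using real_closed_IVT[OF rc 3, of "pderiv P"] neg d by (auto simp: mult_pos_neg)
      then show False using no_critical[of y] x a(1) by simp
    qed
  qed
  have mono: "poly P x < poly P y" if xy: "j a \<le> x" "x < y" "y \<le> j b" for x y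
  proof -
    obtain z where z: "x < z" "z < y" "poly P y - poly P x = (y - x) * poly (pderiv P) z"
      using real_closed_MVT[OF rc xy(2)] by blast
    have "(y - x) * poly (pderiv P) z > 0" using xy z by (intro mult_pos_pos pos) auto
    then show ?thesis using z(3) by simp
  qed
  \<comment> \<open>small enough that \<open>\<alpha> - \<eta>\<close> and \<open>\<alpha> + \<eta>\<close> stay in the region of monotonicity\<close>
  define \<eta> where "\<eta> = min (\<epsilon> / 2) (min (\<alpha> - j a) (j b - \<alpha>))"
  have \<eta>: "\<eta> > 0" "\<eta> < \<epsilon>" "j a \<le> \<alpha> - \<eta>" "\<alpha> + \<eta> \<le> j b"
    using \<open>\<epsilon> > 0\<close> a(1) b(1) by (auto simp: \<eta>_def min_def field_simps)
  have P0: "poly P \<alpha> = 0" using root by (simp add: P_def)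
  have "min (- poly P (\<alpha> - \<eta>)) (poly P (\<alpha> + \<eta>)) > 0"
    using mono[of "\<alpha> - \<eta>" \<alpha>] mono[of \<alpha> "\<alpha> + \<eta>"] \<eta> a(1) b(1) P0 by auto
  then obtain \<delta> where \<delta>: "\<delta> > 0" "j \<delta> < - poly P (\<alpha> - \<eta>)" "j \<delta> < poly P (\<alpha> + \<eta>)"
    using algebraic_imp_coinitial[OF alg] by (metis min_less_iff_conj)
  have "poly p a < 0" "0 < poly p b"
    using mono[of "j a" \<alpha>] mono[of \<alpha> "j b"] a(1) b(1) P0 by (simp_all add: P_def)
  moreover have "j a < j b" using a(1) b(1) by (rule less_trans)
  ultimately obtain c where c: "a < c" "c < b" "\<bar>poly p c\<bar> < \<delta>"
    using ivt \<delta>(1) unfolding approximate_IVT_def map_less_iff by blast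
  have c1: "j a < j c" "j c < j b" using c by simp_all
  have "\<bar>poly P (j c)\<bar> < j \<delta>" unfolding P_def poly_map_poly using c(3) by (simp flip: map_abs)
  then have c2: "poly P (\<alpha> - \<eta>) < poly P (j c)" "poly P (j c) < poly P (\<alpha> + \<eta>)"
    using \<delta>(2,3) by (auto simp: abs_less_iff)
  have "\<alpha> - \<eta> < j c"
    using mono[of "j c" "\<alpha> - \<eta>"] c1 c2(1) \<eta> b(1) by (cases "j c" "\<alpha> - \<eta>" rule: linorder_cases) auto
  moreover have "j c < \<alpha> + \<eta>"
    using mono[of "\<alpha> + \<eta>" "j c"] c1 c2(2) \<eta> a(1) by (cases "j c" "\<alpha> + \<eta>" rule: linorder_cases) auto
  ultimately have "\<bar>\<alpha> - j c\<bar> < \<eta>" by (simp add: abs_less_iff)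
  then show "\<exists>c. \<bar>\<alpha> - j c\<bar> < \<epsilon>" using \<eta>(2) by (meson less_trans)
qed

text \<open>
  Induction on the degree of an annihilating polynomial. The roots of its derivative, among which
  is \<open>\<alpha>\<close> itself if \<open>\<alpha>\<close> is a multiple root, are handled by the induction hypothesis.
\<close>

lemma approximate_IVT_imp_approximable:
  assumes rc: "real_closed TYPE('b)" and alg: "\<And>x. algebraic_via j x"
    and ivt: "\<And>p :: 'a poly. approximate_IVT p"
  shows "approximable \<alpha>"
proof -
  have "approximable \<alpha>" if "p \<noteq> 0" "poly (map_poly j p) \<alpha> = 0" for p \<alpha>
    using that
  proof (induction "degree p" arbitrary: p \<alpha> rule: less_induct)
    case less
    have "degree p \<noteq> 0"
    proof
      assume "degree p = 0"
      then obtain c where "p = [:c:]" by (rule degree_eq_zeroE)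
      then show False using less.prems by simp
    qed
    then have dp: "pderiv p \<noteq> 0" "degree (pderiv p) < degree p"
      using \<open>degree p \<noteq> 0\<close> by (simp_all add: pderiv_eq_0_iff degree_pderiv)
    have critical: "approximable x" if "poly (pderiv (map_poly j p)) x = 0" for x
      using less.hyps[OF dp(2,1)] that by (simp add: map_poly_pderiv)
    have neg: "map_poly j (- p) = - map_poly j p" by (intro poly_eqI) simp
    consider "poly (pderiv (map_poly j p)) \<alpha> = 0" | "poly (pderiv (map_poly j p)) \<alpha> > 0"
      | "poly (pderiv (map_poly j (- p))) \<alpha> > 0"
      unfolding neg pderiv_minus by fastforce
    then show ?case
    proof cases
      case 1
      then show ?thesis by (rule critical)
    next
      case 2
      show ?thesis by (rule simple_root_approximable[OF rc alg ivt less.prems(2) 2 critical])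
    next
      case 3
      have "poly (map_poly j (- p)) \<alpha> = 0" using less.prems(2) by (simp add: neg)
      moreover have "approximable x" if "poly (pderiv (map_poly j (- p))) x = 0" for x
        using critical[of x] that by (simp add: neg pderiv_minus)
      ultimately show ?thesis by (rule simple_root_approximable[OF rc alg ivt _ 3])
    qed
  qed
  then show ?thesis using alg[of \<alpha>] unfolding algebraic_via_def by blast
qed

theorem approximate_IVT_imp_dense:
  assumes rc: "real_closed TYPE('b)" and alg: "\<And>x. algebraic_via j x"
    and ivt: "\<And>p :: 'a poly. approximate_IVT p"
  shows "dense_via j"
  unfolding dense_via_def
proof (intro allI impI)
  fix a b :: 'b assume "a < b"
  then show "\<exists>c. a < j c \<and> j c < b"
    using separate_approximable[OF alg approximate_IVT_imp_approximable[OF rc alg ivt]] by blast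
qed

end

section \<open>Transfer of density between elementarily equivalent fields\<close>

lemma real_closure_embedding:
  fixes j :: "'a::linordered_field \<Rightarrow> 'b::linordered_field"
  assumes "is_real_closure j"
  shows "ordered_embedding j" "real_closed TYPE('b)" "\<And>x. algebraic_via j x"
  using assms unfolding is_real_closure_def ordered_field_embedding_def
  by (auto intro!: ordered_embedding.intro field_embedding.intro ordered_embedding_axioms.intro)

theorem corollary5p2:
  fixes i :: "'k::linordered_field \<Rightarrow> 'krc::linordered_field"
    and j :: "'l::linordered_field \<Rightarrow> 'lrc::linordered_field"
  assumes "elementarily_equivalent TYPE('k) TYPE('l)"
    and "is_real_closure i"
    and "is_real_closure j"
    and "dense_via i"
  shows "dense_via j"
proof -
  have "\<forall>p :: 'k poly. approximate_IVT p"
    using ordered_embedding.dense_imp_approximate_IVT[OF real_closure_embedding(1,2)[OF assms(2)] assms(4)]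
    by blast
  then have "\<forall>d. models TYPE('k) (approximate_IVT_formula d)"
    unfolding models_approximate_IVT .
  then have "\<forall>d. models TYPE('l) (approximate_IVT_formula d)"
    unfolding elementarily_equivalent_models[OF assms(1)] .
  then have "approximate_IVT p" for p :: "'l poly"
    unfolding models_approximate_IVT by blast
  then show ?thesis
    by (rule ordered_embedding.approximate_IVT_imp_dense[OF real_closure_embedding[OF assms(3)]])
qed

end
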